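(* Let $(\Gamma,S)$ be a Delsarte pair and let $\theta$ be the minimum eigenvalue of $\Gamma$. Then: (i) A function $f$ on the vertex set of $\Gamma$ is an eigenfunction with eigenvalue $\theta$ if and only if $\sum_{x\in C}f(x)=0$ for every clique $C\in S$. (ii) A nonempty proper subset $B$ of the vertex set of $\Gamma$ is a completely regular set of covering radius $1$ having $\theta$ as an eigenvalue if and only if $|B\cap C|$ is the same for all cliques $C\in S$.
   Context: A Delsarte pair is a pair $(\Gamma,S)$ where $\Gamma$ is a distance-regular graph of degree $k$ with minimum eigenvalue $\theta_{\min}$, and $S$ is a set of cliques of cardinality $1-k/\theta_{\min}$ (Delsarte cliques) such that every edge of $\Gamma$ lies in exactly $m$ cliques of $S$ for some constant $m$. An eigenfunction with eigenvalue $\theta$ is a non-identically-zero real function $f$ on vertices with $\sum_{y\in\Gamma_1(x)}f(y)=\theta f(x)$ for all $x$. A set $B$ in a $k$-regular graph is completely regular of covering radius $\rho$ if $\Gamma_\rho(B)\neq\emptyset=\Gamma_{\rho+1}(B)$ ($\Gamma_i(B)$ = vertices at distance $i$ from $B$) and there are numbers $b_i,c_i$ ($b_\rho=c_0=0$) with $|\Gamma_{i+1}(B)\cap\Gamma_1(y)|=b_i$, $|\Gamma_{i-1}(B)\cap\Gamma_1(y)|=c_i$ for all $i\le\rho$ and $y\in\Gamma_i(B)$; its eigenvalues are those of the tridiagonal intersection matrix with diagonal $a_i=k-b_i-c_i$, superdiagonal $b_i$, subdiagonal $c_i$.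
   Formalization: Part (i) is stated for functions f that are not identically zero (the zero function has all clique sums zero but is not an eigenfunction), and a Delsarte pair is taken with k > 0 and m > 0, which excludes the one-vertex graph and the empty family S. *)

theory Defs
  imports
    Complex_Main
    "Jordan_Normal_Form.Char_Poly"
    "Graph_Theory.Graph_Theory"
begin

text \<open>
  A finite simple graph is a digraph satisfying the locale predicate \<open>graph\<close> (finite, symmetric,
  no loops, no multiple arcs); adjacency is the relation \<open>u \<rightarrow>\<^bsub>G\<^esub> v\<close>.
\<close>

definition nbrs :: "('a, 'b) pre_digraph \<Rightarrow> 'a \<Rightarrow> 'a set" where
  "nbrs G x = {y. x \<rightarrow>\<^bsub>G\<^esub> y}"

definition set_distance :: "('a, 'b) pre_digraph \<Rightarrow> 'a set \<Rightarrow> 'a \<Rightarrow> ereal" where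
  "set_distance G B v = (INF u\<in>B. wf_digraph.\<mu> G (\<lambda>_. 1) u v)"

text \<open>
  The set $\Gamma_i(B)$.  The index is an integer so that $\Gamma_{-1}(B)$ makes sense; it is
  empty because distances are nonnegative.
\<close>

definition dist_set :: "('a, 'b) pre_digraph \<Rightarrow> 'a set \<Rightarrow> int \<Rightarrow> 'a set" where
  "dist_set G B i = {v \<in> verts G. set_distance G B v = ereal (real_of_int i)}"

lemma dist_set_singleton_1:
  assumes "graph G" "x \<in> verts G"
  shows "dist_set G {x} 1 = nbrs G x"
proof -
  interpret graph G by fact
  have "\<mu> (\<lambda>_. 1) x y = 1 \<longleftrightarrow> x \<rightarrow>\<^bsub>G\<^esub> y" for y
  proof
    assume a: "x \<rightarrow>\<^bsub>G\<^esub> y"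
    then obtain e where e: "e \<in> arcs G" "tail G e = x" "head G e = y" by (auto simp: arcs_ends_conv)
    have "awalk x [e] y" using e by (auto simp: awalk_Cons_iff awalk_Nil_iff)
    moreover have "awalk x p y \<Longrightarrow> p \<noteq> []" for p using e no_loops by (auto simp: awalk_Nil_iff)
    ultimately show "\<mu> (\<lambda>_. 1) x y = 1" unfolding \<mu>_def
      by (intro antisym INF_lower2[of "[e]"] INF_greatest) 
        (auto simp: awalk_cost_def Suc_le_eq sum_list_triv)
  next
    assume a: "\<mu> (\<lambda>_. 1) x y = 1"
    then have "\<mu> (\<lambda>_. 1) x y < 2" by simp
    then obtain p where p: "awalk x p y" "length p < 2" unfolding \<mu>_def INF_less_iff
      by (auto simp: awalk_cost_def sum_list_triv)
    have "p \<noteq> []"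
    proof
      assume "p = []" with p have "x = y" by (auto simp: awalk_Nil_iff)
      with min_cost_le_walk_cost[OF p(1), of "\<lambda>_. 1"] a \<open>p = []\<close> show False by (simp add: awalk_cost_def)
    qed
    with p obtain e where "p = [e]" by (cases p) (auto)
    with p show "x \<rightarrow>\<^bsub>G\<^esub> y" by (auto simp: awalk_Cons_iff awalk_Nil_iff arcs_ends_conv)
  qed
  then show ?thesis by (auto simp: dist_set_def set_distance_def nbrs_def one_ereal_def adj_in_verts)
qed

definition regular_graph :: "('a, 'b) pre_digraph \<Rightarrow> nat \<Rightarrow> bool" where
  "regular_graph G k \<longleftrightarrow> graph G \<and> (\<forall>x\<in>verts G. card (nbrs G x) = k)"

definition distance_regular :: "('a, 'b) pre_digraph \<Rightarrow> nat \<Rightarrow> bool" where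
  "distance_regular G k \<longleftrightarrow>
     regular_graph G k \<and> Digraph_Component.connected G \<and>
     (\<exists>b c :: nat \<Rightarrow> nat. \<forall>i. \<forall>x\<in>verts G. \<forall>y\<in>dist_set G {x} (int i).
        card (dist_set G {x} (int i + 1) \<inter> nbrs G y) = b i \<and>
        card (dist_set G {x} (int i - 1) \<inter> nbrs G y) = c i)"

definition eigenfunction :: "('a, 'b) pre_digraph \<Rightarrow> real \<Rightarrow> ('a \<Rightarrow> real) \<Rightarrow> bool" where
  "eigenfunction G \<theta> f \<longleftrightarrow>
     (\<exists>x\<in>verts G. f x \<noteq> 0) \<and> (\<forall>x\<in>verts G. (\<Sum>y\<in>nbrs G x. f y) = \<theta> * f x)"

text \<open>
  For a finite graph with at least one vertex the set below is finite and nonempty: it is the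
  spectrum of the (real symmetric) adjacency matrix.
\<close>

definition min_eigenvalue :: "('a, 'b) pre_digraph \<Rightarrow> real" where
  "min_eigenvalue G = Min {\<theta>. \<exists>f. eigenfunction G \<theta> f}"

definition clique :: "('a, 'b) pre_digraph \<Rightarrow> 'a set \<Rightarrow> bool" where
  "clique G C \<longleftrightarrow> C \<subseteq> verts G \<and> (\<forall>x\<in>C. \<forall>y\<in>C. x \<noteq> y \<longrightarrow> x \<rightarrow>\<^bsub>G\<^esub> y)"

definition delsarte_clique :: "('a, 'b) pre_digraph \<Rightarrow> nat \<Rightarrow> 'a set \<Rightarrow> bool" where
  "delsarte_clique G k C \<longleftrightarrow>
     clique G C \<and> real (card C) = 1 - real k / min_eigenvalue G"

text \<open>
  The condition \<open>k > 0\<close> excludes the one-vertex graph, whose minimum eigenvalue is $0$, so that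
  $1 - k/\theta_{\min}$ is undefined.  The condition \<open>m > 0\<close> excludes the empty family of cliques.
\<close>

definition delsarte_pair :: "('a, 'b) pre_digraph \<Rightarrow> 'a set set \<Rightarrow> bool" where
  "delsarte_pair G S \<longleftrightarrow>
     (\<exists>k m. distance_regular G k \<and> k > 0 \<and> (\<forall>C\<in>S. delsarte_clique G k C) \<and>
        m > 0 \<and> (\<forall>x y. x \<rightarrow>\<^bsub>G\<^esub> y \<longrightarrow> card {C \<in> S. x \<in> C \<and> y \<in> C} = m))"

definition intersection_numbers ::
  "('a, 'b) pre_digraph \<Rightarrow> 'a set \<Rightarrow> nat \<Rightarrow> (nat \<Rightarrow> nat) \<Rightarrow> (nat \<Rightarrow> nat) \<Rightarrow> bool" where
  "intersection_numbers G B \<rho> b c \<longleftrightarrow>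
     b \<rho> = 0 \<and> c 0 = 0 \<and>
     (\<forall>i\<le>\<rho>. \<forall>y\<in>dist_set G B (int i).
        card (dist_set G B (int i + 1) \<inter> nbrs G y) = b i \<and>
        card (dist_set G B (int i - 1) \<inter> nbrs G y) = c i)"

definition completely_regular :: "('a, 'b) pre_digraph \<Rightarrow> 'a set \<Rightarrow> nat \<Rightarrow> bool" where
  "completely_regular G B \<rho> \<longleftrightarrow>
     (\<exists>k. regular_graph G k) \<and> B \<subseteq> verts G \<and>
     dist_set G B (int \<rho>) \<noteq> {} \<and> dist_set G B (int \<rho> + 1) = {} \<and>
     (\<exists>b c. intersection_numbers G B \<rho> b c)"

definition intersection_matrix ::
  "nat \<Rightarrow> nat \<Rightarrow> (nat \<Rightarrow> nat) \<Rightarrow> (nat \<Rightarrow> nat) \<Rightarrow> real mat" where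
  "intersection_matrix k \<rho> b c = mat (\<rho> + 1) (\<rho> + 1) (\<lambda>(i, j).
     if j = i then real k - real (b i) - real (c i)
     else if j = i + 1 then real (b i)
     else if i = j + 1 then real (c i)
     else 0)"

text \<open>
  For a completely regular set, \<open>k\<close> and the numbers \<open>b i\<close>, \<open>c i\<close> with \<open>i \<le> \<rho>\<close> are uniquely
  determined, so the existential quantifiers below involve no choice.
\<close>

definition cr_eigenvalue :: "('a, 'b) pre_digraph \<Rightarrow> 'a set \<Rightarrow> nat \<Rightarrow> real \<Rightarrow> bool" where
  "cr_eigenvalue G B \<rho> \<theta> \<longleftrightarrow>
     (\<exists>k b c. regular_graph G k \<and> intersection_numbers G B \<rho> b c \<and>
        eigenvalue (intersection_matrix k \<rho> b c) \<theta>)"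

end

theory Submission
  imports Defs
begin

text \<open>
  Let \<open>N\<close> be the vertex-clique incidence matrix of \<open>S\<close>.  Counting the pairs of a neighbour and a
  clique at a vertex shows that every vertex lies in exactly \<open>-m\<theta>\<close> cliques, hence
  $N N^T = m(A - \theta I)$ for the adjacency matrix \<open>A\<close>.  So the eigenspace of \<open>\<theta>\<close> is the kernel of
  $N N^T$, which is the kernel of $N^T$: this is (i).  For (ii), a function that is constant on \<open>B\<close>
  and on its complement is an eigenfunction for \<open>\<theta>\<close> precisely when its two values form an
  eigenvector of the intersection matrix, and by (i) precisely when its sums over the cliques vanish.
\<close>

section \<open>Distance from a set of vertices\<close>

context graph
begin

lemma finite_nbrs [simp]: "finite (nbrs G x)"
  by (rule finite_subset[of _ "verts G"]) (auto simp: nbrs_def adj_in_verts)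

lemma nbrs_subset_verts: "nbrs G x \<subseteq> verts G"
  by (auto simp: nbrs_def adj_in_verts)

lemma not_adj_self: "\<not> x \<rightarrow>\<^bsub>G\<^esub> x"
  using no_loops by (auto simp: arcs_ends_conv)

text \<open>A strict bound on an infimum always has a witness, so this form yields a walk before it
  is known that the infimum is attained.\<close>

lemma set_distance_less_iff:
  "set_distance G B v < ereal r \<longleftrightarrow> (\<exists>u\<in>B. \<exists>p. awalk u p v \<and> real (length p) < r)"
  unfolding set_distance_def \<mu>_def INF_less_iff
  by (auto simp: awalk_cost_def sum_list_triv)

text \<open>Walk lengths are natural numbers, so a distance is \<open>n\<close> precisely when it is
  not below \<open>n\<close> but below \<open>Suc n\<close>. This trades extended reals for
  walks.\<close>

lemma mem_dist_set_iff:
  "v \<in> dist_set G B (int n) \<longleftrightarrow>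
     (\<exists>u\<in>B. \<exists>p. awalk u p v \<and> length p = n) \<and> (\<forall>u\<in>B. \<forall>p. awalk u p v \<longrightarrow> n \<le> length p)"
proof -
  have lt: "set_distance G B v < ereal (real j) \<longleftrightarrow> (\<exists>u\<in>B. \<exists>p. awalk u p v \<and> length p < j)" for j
    by (simp add: set_distance_less_iff)
  have "v \<in> dist_set G B (int n) \<longleftrightarrow> v \<in> verts G \<and> set_distance G B v = ereal (real n)"
    by (simp add: dist_set_def)
  also have "\<dots> \<longleftrightarrow> (\<exists>u\<in>B. \<exists>p. awalk u p v \<and> length p = n) \<and> (\<forall>u\<in>B. \<forall>p. awalk u p v \<longrightarrow> n \<le> length p)"
    (is "?L \<longleftrightarrow> ?R")
  proof
    assume L: ?L
    then have "\<not> set_distance G B v < ereal (real n)" by simp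
    then have ge: "\<forall>u\<in>B. \<forall>p. awalk u p v \<longrightarrow> n \<le> length p" unfolding lt by (auto simp: not_less)
    have "set_distance G B v < ereal (real (Suc n))" using L by simp
    then obtain u p where "u \<in> B" "awalk u p v" "length p < Suc n" unfolding lt by blast
    moreover from this ge have "length p = n" by fastforce
    ultimately show ?R using ge by blast
  next
    assume R: ?R
    then obtain u p where up: "u \<in> B" "awalk u p v" "length p = n" by blast
    have "\<not> set_distance G B v < ereal (real n)" unfolding lt using R by (auto simp: not_less)
    moreover have "set_distance G B v \<le> ereal (real n)"
      unfolding set_distance_def \<mu>_def
      by (rule INF_lower2[OF up(1)], rule INF_lower2[of p])
        (use up in \<open>auto simp: awalk_cost_def sum_list_triv\<close>)
    ultimately show ?L using up by auto
  qed
  finally show ?thesis .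
qed

text \<open>Settles the index -1, which \<open>intersection_numbers\<close> reaches at
  \<open>i = 0\<close>.\<close>

lemma dist_set_neg: "i < 0 \<Longrightarrow> dist_set G B i = {}"
proof -
  assume "i < 0"
  have False if "v \<in> dist_set G B i" for v
  proof -
    have "set_distance G B v < ereal 0" using that \<open>i < 0\<close> by (simp add: dist_set_def)
    then show False unfolding set_distance_less_iff by auto
  qed
  then show ?thesis by blast
qed

lemma awalk_length_1: "(\<exists>p. awalk u p v \<and> length p = 1) \<longleftrightarrow> u \<rightarrow>\<^bsub>G\<^esub> v"
proof
  assume "\<exists>p. awalk u p v \<and> length p = 1"
  then obtain e where "awalk u [e] v" by (auto simp: length_Suc_conv)
  then show "u \<rightarrow>\<^bsub>G\<^esub> v" by (auto simp: awalk_Cons_iff awalk_Nil_iff arcs_ends_conv)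
next
  assume "u \<rightarrow>\<^bsub>G\<^esub> v"
  then obtain e where "e \<in> arcs G" "tail G e = u" "head G e = v" by (auto simp: arcs_ends_conv)
  then have "awalk u [e] v" by (auto simp: awalk_Cons_iff awalk_Nil_iff)
  then show "\<exists>p. awalk u p v \<and> length p = 1" by (intro exI[of _ "[e]"]) simp
qed

lemma dist_set_0:
  assumes "B \<subseteq> verts G"
  shows "dist_set G B 0 = B"
proof -
  have "v \<in> dist_set G B (int 0) \<longleftrightarrow> v \<in> B" for v
    unfolding mem_dist_set_iff using assms by (auto simp: awalk_Nil_iff)
  then show ?thesis by auto
qed

lemma dist_set_1:
  assumes "B \<subseteq> verts G"
  shows "dist_set G B 1 = {v. v \<notin> B \<and> (\<exists>u\<in>B. u \<rightarrow>\<^bsub>G\<^esub> v)}"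
proof -
  have "v \<in> dist_set G B (int 1) \<longleftrightarrow> v \<notin> B \<and> (\<exists>u\<in>B. u \<rightarrow>\<^bsub>G\<^esub> v)" for v
  proof -
    have "(\<forall>u\<in>B. \<forall>p. awalk u p v \<longrightarrow> 1 \<le> length p) \<longleftrightarrow> v \<notin> B"
    proof
      assume *: "\<forall>u\<in>B. \<forall>p. awalk u p v \<longrightarrow> 1 \<le> length p"
      show "v \<notin> B"
      proof
        assume "v \<in> B"
        then have "awalk v [] v" using assms by (auto simp: awalk_Nil_iff)
        with * \<open>v \<in> B\<close> show False by fastforce
      qed
    qed (auto simp: Suc_le_eq awalk_Nil_iff)
    then show ?thesis unfolding mem_dist_set_iff using awalk_length_1 by blast
  qed
  then show ?thesis by auto
qed

text \<open>A walk of length 2 runs through \<open>u\<close>; a walk of length 0 or 1 from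
  \<open>B\<close> would put \<open>w\<close> into \<open>B\<close> or at distance 1.\<close>

lemma dist_set_2_memI:
  assumes "B \<subseteq> verts G" "u \<in> dist_set G B 1" "u \<rightarrow>\<^bsub>G\<^esub> w" "w \<notin> B" "w \<notin> dist_set G B 1"
  shows "w \<in> dist_set G B 2"
proof -
  obtain t where t: "t \<in> B" "t \<rightarrow>\<^bsub>G\<^esub> u" using assms(1,2) by (auto simp: dist_set_1)
  obtain p q where pq: "awalk t p u" "length p = 1" "awalk u q w" "length q = 1"
    using t(2) assms(3) awalk_length_1 by blast
  then have "awalk t (p @ q) w" "length (p @ q) = 2" by auto
  moreover have "2 \<le> length r" if "s \<in> B" "awalk s r w" for s r
  proof (rule ccontr)
    assume "\<not> 2 \<le> length r"
    then consider "length r = 0" | "length r = 1" by linarith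
    then show False
    proof cases
      case 1
      then show ?thesis using that assms(4) by (auto simp: awalk_Nil_iff)
    next
      case 2
      then have "s \<rightarrow>\<^bsub>G\<^esub> w" using that awalk_length_1 by blast
      then show ?thesis using that(1) assms(1,4,5) by (auto simp: dist_set_1)
    qed
  qed
  ultimately have "w \<in> dist_set G B (int 2)" unfolding mem_dist_set_iff using t(1) by blast
  then show ?thesis by simp
qed

lemma connected_closed_set_eq_verts:
  assumes "Digraph_Component.connected G" "U \<subseteq> verts G" "u \<in> U"
    and closed: "\<And>v w. v \<in> U \<Longrightarrow> v \<rightarrow>\<^bsub>G\<^esub> w \<Longrightarrow> w \<in> U"
  shows "U = verts G"
proof -
  have "strongly_connected G"
    using sym_arcs assms(1) by (rule symmetric_connected_imp_strongly_connected)
  have "w \<in> U" if "w \<in> verts G" for w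
  proof -
    have "u \<rightarrow>\<^sup>*\<^bsub>G\<^esub> w"
      using \<open>strongly_connected G\<close> that assms(2,3) by (auto simp: strongly_connected_def)
    then show ?thesis
      by (induction rule: reachable_induct) (use assms(3) closed in auto)
  qed
  then show ?thesis using assms(2) by auto
qed

text \<open>With nothing at distance 2, no edge leaves the union of \<open>B\<close> and its
  neighbours, so by connectedness this union contains every vertex.\<close>

lemma dist_set_1_eq_Diff:
  assumes "Digraph_Component.connected G" "B \<subseteq> verts G" "B \<noteq> {}" "dist_set G B 2 = {}"
  shows "dist_set G B 1 = verts G - B"
proof -
  obtain u where u: "u \<in> B" using assms(3) by blast
  have sub: "dist_set G B 1 \<subseteq> verts G" by (auto simp: dist_set_def)
  have "B \<union> dist_set G B 1 = verts G"
  proof (rule connected_closed_set_eq_verts[OF assms(1), of _ u])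
    fix v w assume vw: "v \<in> B \<union> dist_set G B 1" "v \<rightarrow>\<^bsub>G\<^esub> w"
    show "w \<in> B \<union> dist_set G B 1"
    proof (cases "v \<in> B")
      case True
      then show ?thesis using vw assms(2) by (auto simp: dist_set_1)
    next
      case False
      then show ?thesis using vw dist_set_2_memI[OF assms(2), of v w] assms(4) by auto
    qed
  qed (use u sub assms(2) in auto)
  moreover have "dist_set G B 1 \<inter> B = {}" using assms(2) by (auto simp: dist_set_1)
  ultimately show ?thesis by auto
qed

end

section \<open>The incidence matrix of the cliques\<close>

locale clique_family = graph G for G :: "('a, 'b) pre_digraph" +
  fixes S :: "'a set set" and m :: nat
  assumes clique_mem: "C \<in> S \<Longrightarrow> clique G C"
    and card_edge: "x \<rightarrow>\<^bsub>G\<^esub> y \<Longrightarrow> card {C \<in> S. x \<in> C \<and> y \<in> C} = m"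
begin

lemma subset_verts: "C \<in> S \<Longrightarrow> C \<subseteq> verts G"
  using clique_mem by (auto simp: clique_def)

lemma finite_S: "finite S"
  by (rule finite_subset[of _ "Pow (verts G)"]) (use subset_verts in auto)

lemma finite_mem: "C \<in> S \<Longrightarrow> finite C"
  by (rule finite_subset[OF subset_verts finite_verts])

text \<open>This is the entry at \<open>x\<close> of $N N^T f$. After the sums are swapped,
  \<open>f y\<close> is counted once for every clique through both \<open>x\<close> and
  \<open>y\<close>: \<open>m\<close> times for a neighbour, never for any other vertex distinct from
  \<open>x\<close>.\<close>

lemma sum_cliques_at_vertex:
  fixes f :: "'a \<Rightarrow> real"
  assumes "x \<in> verts G"
  shows "(\<Sum>C\<in>{C\<in>S. x \<in> C}. \<Sum>y\<in>C. f y) = real (card {C\<in>S. x \<in> C}) * f x + real m * (\<Sum>y\<in>nbrs G x. f y)"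
proof -
  let ?c = "\<lambda>y. card {C \<in> S. x \<in> C \<and> y \<in> C}"
  have "(\<Sum>C\<in>{C\<in>S. x \<in> C}. \<Sum>y\<in>C. f y) = (\<Sum>C\<in>{C\<in>S. x \<in> C}. \<Sum>y\<in>{y\<in>verts G. y \<in> C}. f y)"
    by (intro sum.cong refl) (use subset_verts in auto)
  also have "\<dots> = (\<Sum>y\<in>verts G. \<Sum>C\<in>{C\<in>{C\<in>S. x \<in> C}. y \<in> C}. f y)"
    by (rule sum.swap_restrict) (use finite_S in auto)
  also have "\<dots> = (\<Sum>y\<in>verts G. real (?c y) * f y)"
    by (simp add: conj_assoc)
  also have "\<dots> = (\<Sum>y\<in>insert x (nbrs G x). real (?c y) * f y)"
  proof (rule sum.mono_neutral_right)
    show "\<forall>y\<in>verts G - insert x (nbrs G x). real (?c y) * f y = 0"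
    proof
      fix y assume "y \<in> verts G - insert x (nbrs G x)"
      then have "{C \<in> S. x \<in> C \<and> y \<in> C} = {}"
        using clique_mem by (auto simp: nbrs_def clique_def)
      then show "real (?c y) * f y = 0" by (simp only: card.empty of_nat_0 mult_zero_left)
    qed
  qed (use assms nbrs_subset_verts in auto)
  also have "\<dots> = real (?c x) * f x + (\<Sum>y\<in>nbrs G x. real (?c y) * f y)"
    using not_adj_self by (subst sum.insert) (simp_all add: nbrs_def[of G x, THEN eqset_imp_iff])
  also have "(\<Sum>y\<in>nbrs G x. real (?c y) * f y) = real m * (\<Sum>y\<in>nbrs G x. f y)"
    unfolding sum_distrib_left by (rule sum.cong) (auto simp: nbrs_def card_edge)
  finally show ?thesis by simp
qed

text \<open>The identity $|N^T f|^2 = (f, N N^T f)$. It turns vanishing of $N N^T f$ into vanishing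
  of every clique sum.\<close>

lemma sum_clique_sums_squared:
  fixes f :: "'a \<Rightarrow> real"
  shows "(\<Sum>C\<in>S. (\<Sum>x\<in>C. f x)\<^sup>2) = (\<Sum>x\<in>verts G. f x * (\<Sum>C\<in>{C\<in>S. x \<in> C}. \<Sum>y\<in>C. f y))"
proof -
  have "(\<Sum>C\<in>S. (\<Sum>x\<in>C. f x)\<^sup>2) = (\<Sum>C\<in>S. \<Sum>x\<in>{x\<in>verts G. x \<in> C}. f x * (\<Sum>y\<in>C. f y))"
  proof (rule sum.cong[OF refl])
    fix C assume "C \<in> S"
    then have "{x\<in>verts G. x \<in> C} = C" using subset_verts by auto
    then show "(\<Sum>x\<in>C. f x)\<^sup>2 = (\<Sum>x\<in>{x\<in>verts G. x \<in> C}. f x * (\<Sum>y\<in>C. f y))"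
      by (simp add: power2_eq_square sum_distrib_right)
  qed
  also have "\<dots> = (\<Sum>x\<in>verts G. \<Sum>C\<in>{C\<in>S. x \<in> C}. f x * (\<Sum>y\<in>C. f y))"
    by (rule sum.swap_restrict) (use finite_S in auto)
  finally show ?thesis by (simp add: sum_distrib_left)
qed

end

lemma sum_two_valued:
  fixes s t :: real
  assumes "finite A"
  shows "(\<Sum>y\<in>A. if y \<in> B then s else t) = real (card (B \<inter> A)) * s + (real (card A) - real (card (B \<inter> A))) * t"
proof -
  have "card A = card (A \<inter> B) + card (A - B)"
    by (metis assms card_Diff_subset_Int card_mono finite_Int inf_le1 le_add_diff_inverse)
  then show ?thesis
    using assms by (simp add: sum.If_cases Int_commute Diff_eq[symmetric])
qed

section \<open>The number of cliques at a vertex and the eigenspace of \<theta>\<close>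

locale delsarte_family = clique_family G S m for G :: "('a, 'b) pre_digraph" and S m +
  fixes k :: nat and \<theta> :: real
  assumes card_nbrs: "x \<in> verts G \<Longrightarrow> card (nbrs G x) = k"
    and connected: "Digraph_Component.connected G"
    and k_pos: "k > 0" and m_pos: "m > 0"
    and card_clique: "C \<in> S \<Longrightarrow> real (card C) = 1 - real k / \<theta>"
begin

text \<open>Apply the count at \<open>x\<close> to the constant function 1: the cliques at
  \<open>x\<close> have total size (number of cliques) + \<open>m * k\<close>. The equation is kept
  as a product because \<theta> is not yet known to be nonzero.\<close>

lemma card_cliques_at_vertex_times:
  assumes "x \<in> verts G"
  shows "real (card {C\<in>S. x \<in> C}) * (- real k / \<theta>) = real m * real k"
proof -
  have "(\<Sum>C\<in>{C\<in>S. x \<in> C}. \<Sum>y\<in>C. 1) = (\<Sum>C\<in>{C\<in>S. x \<in> C}. 1 - real k / \<theta>)"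
    by (rule sum.cong) (auto simp: card_clique)
  with sum_cliques_at_vertex[OF assms, of "\<lambda>_. 1"] card_nbrs[OF assms]
  show ?thesis by (simp add: algebra_simps)
qed

lemma verts_nonempty: "verts G \<noteq> {}"
  using symmetric_connected_imp_strongly_connected[OF sym_arcs connected]
  unfolding strongly_connected_def by blast

text \<open>The sign comes from counting: the product in \<open>card_cliques_at_vertex_times\<close>
  is positive and one factor is a cardinality, so \<open>- real k / \<theta>\<close> is positive.
  The case \<theta> = 0, where this quotient has the default value 0, is thereby excluded
  too.\<close>

lemma theta_neg: "\<theta> < 0"
proof -
  obtain x where x: "x \<in> verts G" using verts_nonempty by blast
  have "real (card {C\<in>S. x \<in> C}) * (- real k / \<theta>) > 0"
    using card_cliques_at_vertex_times[OF x] k_pos m_pos by simp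
  then have "- real k / \<theta> > 0" by (simp only: zero_less_mult_iff of_nat_less_0_iff simp_thms)
  then show ?thesis using k_pos by (simp add: divide_simps split: if_splits)
qed

lemma card_cliques_at_vertex:
  assumes "x \<in> verts G"
  shows "real (card {C\<in>S. x \<in> C}) = - real m * \<theta>"
proof -
  have "real (card {C\<in>S. x \<in> C}) * (- real k / \<theta>) = (- real m * \<theta>) * (- real k / \<theta>)"
    unfolding card_cliques_at_vertex_times[OF assms] using theta_neg by simp
  moreover have "- real k / \<theta> \<noteq> 0" using theta_neg k_pos by simp
  ultimately show ?thesis using mult_right_cancel by blast
qed

lemma sum_cliques_at_vertex_eq:
  fixes f :: "'a \<Rightarrow> real"
  assumes "x \<in> verts G"
  shows "(\<Sum>C\<in>{C\<in>S. x \<in> C}. \<Sum>y\<in>C. f y) = real m * ((\<Sum>y\<in>nbrs G x. f y) - \<theta> * f x)"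
  using sum_cliques_at_vertex[OF assms, of f] card_cliques_at_vertex[OF assms]
  by (simp add: algebra_simps)

lemma eigenequation_iff_clique_sums_zero:
  fixes f :: "'a \<Rightarrow> real"
  shows "(\<forall>x\<in>verts G. (\<Sum>y\<in>nbrs G x. f y) = \<theta> * f x) \<longleftrightarrow> (\<forall>C\<in>S. (\<Sum>x\<in>C. f x) = 0)"
    (is "?L \<longleftrightarrow> ?R")
proof
  assume ?L
  then have "(\<Sum>C\<in>S. (\<Sum>x\<in>C. f x)\<^sup>2) = 0"
    unfolding sum_clique_sums_squared by (intro sum.neutral) (auto simp: sum_cliques_at_vertex_eq)
  then show ?R using finite_S by (simp add: sum_nonneg_eq_0_iff)
next
  assume R: ?R
  show ?L
  proof
    fix x assume x: "x \<in> verts G"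
    have "(\<Sum>C\<in>{C\<in>S. x \<in> C}. \<Sum>y\<in>C. f y) = 0" using R by (intro sum.neutral) auto
    then show "(\<Sum>y\<in>nbrs G x. f y) = \<theta> * f x" using sum_cliques_at_vertex_eq[OF x] m_pos by simp
  qed
qed

section \<open>Two-valued functions and the intersection matrix of radius one\<close>

lemma sum_nbrs_two_valued:
  fixes s t :: real
  assumes "x \<in> verts G"
  shows "(\<Sum>y\<in>nbrs G x. if y \<in> B then s else t)
    = real (card (B \<inter> nbrs G x)) * s + (real k - real (card (B \<inter> nbrs G x))) * t"
  using assms by (simp add: sum_two_valued card_nbrs)

text \<open>As all cliques in \<open>S\<close> have the same size, the sum depends on
  \<open>C\<close> only through the size of its intersection with \<open>B\<close>.\<close>

lemma sum_clique_two_valued: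
  fixes s t :: real
  assumes "C \<in> S"
  shows "(\<Sum>y\<in>C. if y \<in> B then s else t)
    = real (card (B \<inter> C)) * s + (1 - real k / \<theta> - real (card (B \<inter> C))) * t"
  using assms by (simp add: sum_two_valued finite_mem card_clique)

text \<open>Both cells are described by neighbours in \<open>B\<close> alone: by regularity the
  neighbours outside \<open>B\<close> are the remaining ones. The condition on \<open>b 0\<close> is
  put in the reals to avoid truncated subtraction.\<close>

lemma intersection_numbers_radius_1:
  assumes "B \<subseteq> verts G" "dist_set G B 1 = verts G - B" "dist_set G B 2 = {}"
  shows "intersection_numbers G B 1 b c \<longleftrightarrow> b 1 = 0 \<and> c 0 = 0 \<and>
    (\<forall>y\<in>B. real (card (B \<inter> nbrs G y)) = real k - real (b 0)) \<and>
    (\<forall>y\<in>verts G - B. card (B \<inter> nbrs G y) = c 1)"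
proof -
  have compl: "card ((verts G - B) \<inter> nbrs G y) = b 0 \<longleftrightarrow> real (card (B \<inter> nbrs G y)) = real k - real (b 0)"
    if "y \<in> B" for y
  proof -
    have "(verts G - B) \<inter> nbrs G y = nbrs G y - B" using nbrs_subset_verts by auto
    moreover have "card (nbrs G y) = card (B \<inter> nbrs G y) + card (nbrs G y - B)"
      by (metis Int_commute card_Diff_subset_Int card_mono finite_Int finite_nbrs inf_le2 le_add_diff_inverse)
    ultimately show ?thesis using card_nbrs[of y] assms(1) that by auto
  qed
  have le_1: "(\<forall>i\<le>1. P i) \<longleftrightarrow> P 0 \<and> P 1" for P :: "nat \<Rightarrow> bool"
    by (metis One_nat_def le_SucE le_zero_eq order_refl zero_le)
  show ?thesis
    unfolding intersection_numbers_def le_1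
    using assms by (auto simp: dist_set_0 dist_set_neg compl)
qed

end

lemma eigenvalue_intersection_matrix_1:
  "eigenvalue (intersection_matrix k 1 b c) \<theta> \<longleftrightarrow>
    (\<exists>s t. (s \<noteq> 0 \<or> t \<noteq> 0) \<and>
      (real k - real (b 0) - real (c 0)) * s + real (b 0) * t = \<theta> * s \<and>
      real (c 1) * s + (real k - real (b 1) - real (c 1)) * t = \<theta> * t)" (is "?L \<longleftrightarrow> ?R")
proof -
  have row: "(intersection_matrix k 1 b c *\<^sub>v v = \<theta> \<cdot>\<^sub>v v) \<longleftrightarrow>
      (real k - real (b 0) - real (c 0)) * v $ 0 + real (b 0) * v $ 1 = \<theta> * v $ 0 \<and>
      real (c 1) * v $ 0 + (real k - real (b 1) - real (c 1)) * v $ 1 = \<theta> * v $ 1"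
    if "v \<in> carrier_vec 2" for v
    using that
    by (auto simp: intersection_matrix_def vec_eq_iff less_Suc_eq scalar_prod_def numeral_2_eq_2)
  have nz: "v \<noteq> 0\<^sub>v 2 \<longleftrightarrow> v $ 0 \<noteq> 0 \<or> v $ 1 \<noteq> 0" if "v \<in> carrier_vec 2" for v :: "real vec"
    using that by (auto simp: vec_eq_iff less_2_cases_iff)
  have dim: "dim_row (intersection_matrix k 1 b c) = 2" by (simp add: intersection_matrix_def)
  show ?thesis
  proof
    assume ?L
    then obtain v where v: "v \<in> carrier_vec 2" "v \<noteq> 0\<^sub>v 2"
      "intersection_matrix k 1 b c *\<^sub>v v = \<theta> \<cdot>\<^sub>v v"
      unfolding eigenvalue_def eigenvector_def dim by blast
    then show ?R unfolding row[OF v(1)] nz[OF v(1)] by blast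
  next
    assume ?R
    then obtain s t where st: "s \<noteq> 0 \<or> t \<noteq> 0"
      "(real k - real (b 0) - real (c 0)) * s + real (b 0) * t = \<theta> * s"
      "real (c 1) * s + (real k - real (b 1) - real (c 1)) * t = \<theta> * t" by blast
    define v where "v = vec 2 (\<lambda>i. if i = 0 then s else t)"
    have v: "v \<in> carrier_vec 2" and "v $ 0 = s" "v $ 1 = t" by (simp_all add: v_def)
    with st row[OF v] nz[OF v] have "eigenvector (intersection_matrix k 1 b c) v \<theta>"
      unfolding eigenvector_def dim by blast
    then show ?L by (auto simp: eigenvalue_def)
  qed
qed

section \<open>Completely regular sets of covering radius one\<close>

context delsarte_family
begin

text \<open>Fixes the degree that is existentially quantified in \<open>completely_regular\<close>
  and \<open>cr_eigenvalue\<close>; a vertex must exist for it to be unique.\<close>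

lemma regular_graph_iff: "regular_graph G j \<longleftrightarrow> j = k"
proof -
  obtain x where "x \<in> verts G" using verts_nonempty by blast
  then show ?thesis unfolding regular_graph_def using card_nbrs graph_axioms by metis
qed

text \<open>An eigenvector \<open>(s, t)\<close> of the intersection matrix lifts to the function
  with value \<open>s\<close> on \<open>B\<close> and \<open>t\<close> elsewhere, which satisfies
  the eigenequation. Its clique sums vanish, and this determines the size of each
  intersection.\<close>

lemma constant_clique_intersection_if_cr:
  assumes B: "B \<noteq> {}" "B \<subset> verts G" and cr: "completely_regular G B 1" and ev: "cr_eigenvalue G B 1 \<theta>"
  shows "\<exists>n. \<forall>C\<in>S. card (B \<inter> C) = n"
proof -
  have d2: "dist_set G B 2 = {}" using cr by (simp add: completely_regular_def)
  then have d1: "dist_set G B 1 = verts G - B" using B connected dist_set_1_eq_Diff by blast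
  obtain b c where num: "intersection_numbers G B 1 b c"
    and eig: "eigenvalue (intersection_matrix k 1 b c) \<theta>"
    using ev by (auto simp: cr_eigenvalue_def regular_graph_iff)
  note num = num[unfolded intersection_numbers_radius_1[OF psubset_imp_subset[OF B(2)] d1 d2]]
  obtain s t where nz: "s \<noteq> 0 \<or> t \<noteq> 0"
    and row0: "(real k - real (b 0)) * s + real (b 0) * t = \<theta> * s"
    and row1: "real (c 1) * s + (real k - real (c 1)) * t = \<theta> * t"
    using eig[unfolded eigenvalue_intersection_matrix_1] num by auto
  \<comment> \<open>The rows of the intersection matrix sum to \<open>k\<close>, so a constant
    eigenvector would belong to \<open>k\<close>, which is positive.\<close>
  have "s \<noteq> t"
  proof
    assume "s = t"
    with row0 nz have "real k = \<theta>" by (auto simp: algebra_simps)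
    then show False using theta_neg by simp
  qed
  have "\<forall>x\<in>verts G. (\<Sum>y\<in>nbrs G x. if y \<in> B then s else t) = \<theta> * (if x \<in> B then s else t)"
    using num row0 row1 by (auto simp: sum_nbrs_two_valued)
  then have zero: "\<forall>C\<in>S. (\<Sum>y\<in>C. if y \<in> B then s else t) = 0"
    by (simp only: eigenequation_iff_clique_sums_zero)
  \<comment> \<open>With clique size \<open>q\<close> and intersection size \<open>j\<close>, the
    equation \<open>j * s + (q - j) * t = 0\<close> is solved for \<open>j\<close>; the solution
    does not involve \<open>C\<close>.\<close>
  have "real (card (B \<inter> C)) = (1 - real k / \<theta>) * t / (t - s)" if "C \<in> S" for C
    using zero that \<open>s \<noteq> t\<close> sum_clique_two_valued[OF that, of B s t] by (simp add: field_simps)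
  then have "card (B \<inter> C) = card (B \<inter> D)" if "C \<in> S" "D \<in> S" for C D
    using that by (metis of_nat_eq_iff)
  then show ?thesis by blast
qed

text \<open>The eigenequation for a suitable two-valued function gives the number of neighbours in
  \<open>B\<close> of each vertex, and this number depends only on whether the vertex lies in
  \<open>B\<close>.\<close>

lemma cr_if_constant_clique_intersection:
  assumes B: "B \<noteq> {}" "B \<subset> verts G" and n: "\<forall>C\<in>S. card (B \<inter> C) = n"
  shows "completely_regular G B 1 \<and> cr_eigenvalue G B 1 \<theta>"
proof -
  have BV: "B \<subseteq> verts G" using B by blast
  define q where "q = 1 - real k / \<theta>"
  have q: "q > 0" "q * \<theta> = \<theta> - real k"
    using theta_neg by (auto simp: q_def field_simps)
  \<comment> \<open>The function is \<open>q\<close> times the indicator of \<open>B\<close>, minus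
    \<open>n\<close>. On a clique of size \<open>q\<close> with \<open>n\<close> vertices in
    \<open>B\<close> its sum is \<open>q * n - n * q\<close>.\<close>
  have "\<forall>C\<in>S. (\<Sum>y\<in>C. if y \<in> B then q - real n else - real n) = 0"
    using n by (auto simp: sum_clique_two_valued q_def[symmetric] algebra_simps)
  then have "\<forall>x\<in>verts G. (\<Sum>y\<in>nbrs G x. if y \<in> B then q - real n else - real n)
      = \<theta> * (if x \<in> B then q - real n else - real n)"
    by (simp only: eigenequation_iff_clique_sums_zero)
  \<comment> \<open>The eigenequation at \<open>x\<close>, with \<open>q * n * \<theta>\<close>
    added to both sides so that the last bracket vanishes by the value of \<open>q\<close> and the
    factor \<open>q\<close> can be cancelled.\<close>
  then have "q * (real (card (B \<inter> nbrs G x)) + real n * \<theta>) = (if x \<in> B then q * \<theta> else 0) + real n * (real k - \<theta> + q * \<theta>)"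
    if "x \<in> verts G" for x
    using that by (auto simp: sum_nbrs_two_valued algebra_simps)
  moreover have "real k - \<theta> + q * \<theta> = 0" using q by simp
  ultimately have "q * (real (card (B \<inter> nbrs G x)) + real n * \<theta>) = q * (if x \<in> B then \<theta> else 0)"
    if "x \<in> verts G" for x
    using that by simp
  then have num: "real (card (B \<inter> nbrs G x)) = (if x \<in> B then \<theta> else 0) - real n * \<theta>" if "x \<in> verts G" for x
    using that q(1) by (metis add_diff_cancel_right' mult_left_cancel less_irrefl)
  \<comment> \<open>Each vertex of \<open>B\<close> lies in \<open>- m * \<theta>\<close> cliques, a
    positive number, so some clique meets \<open>B\<close>; by constancy all do.\<close>
  have "n > 0"
  proof -
    obtain x where x: "x \<in> B" using B by blast
    have "0 < - real m * \<theta>" using m_pos theta_neg by (simp add: mult_pos_neg)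
    also have "\<dots> = real (card {C\<in>S. x \<in> C})" using card_cliques_at_vertex[of x] x BV by auto
    finally obtain C where "C \<in> S" "x \<in> C" by (auto simp: card_gt_0_iff)
    then show ?thesis using n x finite_mem by (metis IntI card_gt_0_iff empty_iff finite_Int)
  qed
  \<comment> \<open>By \<open>num\<close>, a vertex outside \<open>B\<close> has
    \<open>- n * \<theta>\<close> neighbours in \<open>B\<close>, which is positive.\<close>
  have d1: "dist_set G B 1 = verts G - B"
  proof -
    have "\<exists>u\<in>B. u \<rightarrow>\<^bsub>G\<^esub> v" if "v \<in> verts G - B" for v
    proof -
      have "real (card (B \<inter> nbrs G v)) > 0"
        using num[of v] that \<open>n > 0\<close> theta_neg by (simp add: mult_pos_neg)
      then have "B \<inter> nbrs G v \<noteq> {}" by auto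
      then show ?thesis by (auto simp: nbrs_def dest: graph_symmetric)
    qed
    then show ?thesis using BV by (auto simp: dist_set_1 adj_in_verts)
  qed
  have d2: "dist_set G B 2 = {}"
  proof -
    have "dist_set G B 2 \<subseteq> verts G" "dist_set G B 2 \<inter> dist_set G B 0 = {}"
      "dist_set G B 2 \<inter> dist_set G B 1 = {}" by (auto simp: dist_set_def)
    then show ?thesis using d1 dist_set_0[OF BV] by auto
  qed
  obtain x y where xy: "x \<in> B" "y \<in> verts G - B" using B by blast
  \<comment> \<open>The numbers are read off at one vertex of each cell; \<open>num\<close> makes
    the choice immaterial.\<close>
  define b where "b i = (if i = 0 then k - card (B \<inter> nbrs G x) else 0)" for i :: nat
  define c where "c i = (if i = 0 then 0 else card (B \<inter> nbrs G y))" for i :: nat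
  have "card (B \<inter> nbrs G x) \<le> k"
    using card_nbrs[of x] xy BV by (metis card_mono finite_nbrs inf_le2 subsetD)
  then have b0: "real k - real (b 0) = \<theta> - real n * \<theta>"
    using num[of x] xy BV by (auto simp: b_def of_nat_diff)
  have c1: "real (c 1) = - real n * \<theta>"
    using num[of y] xy by (auto simp: c_def)
  have numbers: "intersection_numbers G B 1 b c"
    unfolding intersection_numbers_radius_1[OF BV d1 d2] of_nat_eq_iff[where 'a = real, symmetric]
    using num BV c1 b0 by (auto simp: b_def c_def)
  have "real (c 1) > 0" unfolding c1 using \<open>n > 0\<close> theta_neg by (simp add: mult_pos_neg)
  have "eigenvalue (intersection_matrix k 1 b c) \<theta>"
    unfolding eigenvalue_intersection_matrix_1
  proof (intro exI conjI)
    have z: "c 0 = 0" "b 1 = 0" by (simp_all add: b_def c_def)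
    have sum: "\<theta> = real k - real (b 0) - real (c 1)" using b0 c1 by simp
    \<comment> \<open>The eigenvalues of the matrix are \<open>k\<close>, from the constant vector,
      and \<open>k - b 0 - c 1\<close>, with eigenvector \<open>(b 0, - c 1)\<close>. The latter
      equals \<theta> by \<open>sum\<close>.\<close>
    show "real (b 0) \<noteq> 0 \<or> - real (c 1) \<noteq> 0" using \<open>real (c 1) > 0\<close> by simp
    show "(real k - real (b 0) - real (c 0)) * real (b 0) + real (b 0) * - real (c 1) = \<theta> * real (b 0)"
      unfolding sum z by (simp add: algebra_simps)
    show "real (c 1) * real (b 0) + (real k - real (b 1) - real (c 1)) * - real (c 1) = \<theta> * - real (c 1)"
      unfolding sum z by (simp add: algebra_simps)
  qed
  then have "cr_eigenvalue G B 1 \<theta>"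
    using numbers by (auto simp: cr_eigenvalue_def regular_graph_iff)
  moreover have "completely_regular G B 1"
    using numbers BV d1 d2 xy by (auto simp: completely_regular_def regular_graph_iff)
  ultimately show ?thesis by blast
qed

end

section \<open>Both claims for a Delsarte pair\<close>

theorem theorem2:
  fixes G :: "('a, 'b) pre_digraph" and S :: "'a set set" and \<theta> :: real
  assumes "delsarte_pair G S" and "\<theta> = min_eigenvalue G"
  shows "(\<forall>f :: 'a \<Rightarrow> real. (\<exists>x\<in>verts G. f x \<noteq> 0) \<longrightarrow>
            (eigenfunction G \<theta> f \<longleftrightarrow> (\<forall>C\<in>S. (\<Sum>x\<in>C. f x) = 0))) \<and>
         (\<forall>B. B \<noteq> {} \<and> B \<subset> verts G \<longrightarrow>
            (completely_regular G B 1 \<and> cr_eigenvalue G B 1 \<theta> \<longleftrightarrow>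
             (\<exists>n. \<forall>C\<in>S. card (B \<inter> C) = n)))"
proof -
  obtain k m where dr: "distance_regular G k" "k > 0" "\<forall>C\<in>S. delsarte_clique G k C" "m > 0"
    "\<forall>x y. x \<rightarrow>\<^bsub>G\<^esub> y \<longrightarrow> card {C \<in> S. x \<in> C \<and> y \<in> C} = m"
    using assms(1) unfolding delsarte_pair_def by blast
  then have "graph G" by (simp add: distance_regular_def regular_graph_def)
  interpret graph G by fact
  interpret delsarte_family G S m k \<theta>
  proof
    show "clique G C" "real (card C) = 1 - real k / \<theta>" if "C \<in> S" for C
      using dr(3) that assms(2) by (simp_all add: delsarte_clique_def)
    show "card {C \<in> S. x \<in> C \<and> y \<in> C} = m" if "x \<rightarrow>\<^bsub>G\<^esub> y" for x y
      using dr(5) that by blast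
    show "card (nbrs G x) = k" if "x \<in> verts G" for x
      using dr(1) that by (simp add: distance_regular_def regular_graph_def)
    show "Digraph_Component.connected G"
      using dr(1) by (simp add: distance_regular_def)
  qed (use dr in simp_all)
  show ?thesis
  proof (intro conjI allI impI)
    fix f :: "'a \<Rightarrow> real" assume "\<exists>x\<in>verts G. f x \<noteq> 0"
    then show "eigenfunction G \<theta> f \<longleftrightarrow> (\<forall>C\<in>S. (\<Sum>x\<in>C. f x) = 0)"
      unfolding eigenfunction_def eigenequation_iff_clique_sums_zero by blast
  next
    fix B assume "B \<noteq> {} \<and> B \<subset> verts G"
    then show "completely_regular G B 1 \<and> cr_eigenvalue G B 1 \<theta> \<longleftrightarrow> (\<exists>n. \<forall>C\<in>S. card (B \<inter> C) = n)"
      using constant_clique_intersection_if_cr[of B] cr_if_constant_clique_intersection[of B] by metis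
  qed
qed

end
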